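(* Let $(\mathcal{N},[\cdot,\dots,\cdot],\tilde\alpha)$, $\tilde\alpha=(\alpha_1,\dots,\alpha_{n-1})$, be an $n$-ary Hom-Nambu algebra. For $x=(x_1,\dots,x_{n-1})\in\mathcal{N}^{n-1}$ let $L(x)\cdot z=[x_1,\dots,x_{n-1},z]$ for $z\in\mathcal{N}$, let $\widetilde{L}(x)\in End(\mathcal{N}^* )$ be given by $(\widetilde{L}(x)\cdot f)(y)=-f(L(x)\cdot y)$ for $f\in\mathcal{N}^*$, $y\in\mathcal{N}$, and let $\alpha_{n-1}^*(f)=f\circ\alpha_{n-1}$ for $f\in\mathcal{N}^*$. If there exists a bilinear form $B:\mathcal{N}\times\mathcal{N}\to\mathbb{K}$ such that $(\mathcal{N},[\cdot,\dots,\cdot],\tilde\alpha,B)$ is a quadratic $n$-ary Hom-Nambu algebra, then: 1. $(\mathcal{N}^*,\widetilde{L},\alpha_{n-1}^* )$ is a representation of $\mathcal{N}$; 2. the representations $(\mathcal{N},L,\alpha_{n-1})$ and $(\mathcal{N}^*,\widetilde{L},\alpha_{n-1}^* )$ are isomorphic.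
   Context: $\mathbb{K}$ is an algebraically closed field of characteristic zero. An $n$-ary Hom-Nambu algebra is a triple $(\mathcal{N},[\cdot,\dots,\cdot],\tilde\alpha)$ with $\mathcal{N}$ a $\mathbb{K}$-vector space, $[\cdot,\dots,\cdot]:\mathcal{N}^n\to\mathcal{N}$ an $n$-linear map and $\tilde\alpha=(\alpha_1,\dots,\alpha_{n-1})$ a family of linear maps $\mathcal{N}\to\mathcal{N}$ such that the Hom-Nambu identity holds: $$[\alpha_1(x_1),\dots,\alpha_{n-1}(x_{n-1}),[y_1,\dots,y_n]]=\sum_{i=1}^n[\alpha_1(y_1),\dots,\alpha_{i-1}(y_{i-1}),[x_1,\dots,x_{n-1},y_i],\alpha_i(y_{i+1}),\dots,\alpha_{n-1}(y_n)].$$ $(\mathcal{N},[\cdot,\dots,\cdot],\tilde\alpha,B)$ is a quadratic $n$-ary Hom-Nambu algebra if $B$ is a nondegenerate symmetric bilinear form on $\mathcal{N}$ with $B([x_1,\dots,x_{n-1},y],z)+B(y,[x_1,\dots,x_{n-1},z])=0$ and $B(\alpha_i(y),z)=B(y,\alpha_i(z))$ for all $x_j,y,z\in\mathcal{N}$ and all $i\in\{1,\dots,n-1\}$. For $x\in\mathcal{N}^{n-1}$ write $\tilde\alpha(x)=(\alpha_1(x_1),\dots,\alpha_{n-1}(x_{n-1}))$. A representation $(V,\rho,\nu)$ of $\mathcal{N}$ on a vector space $V$ is a skew-symmetric multilinear map $\rho:\mathcal{N}^{n-1}\to End(V)$ satisfying, for all $x,y\in\mathcal{N}^{n-1}$,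 $$\rho(\tilde\alpha(x))\circ\rho(y)-\rho(\tilde\alpha(y))\circ\rho(x)=\sum_{i=1}^{n-1}\rho\big(\alpha_1(y_1),\dots,\alpha_{i-1}(y_{i-1}),L(x)\cdot y_i,\alpha_i(y_{i+1}),\dots,\alpha_{n-2}(y_{n-1})\big)\circ\nu,$$ where $\nu$ is an endomorphism of $V$. (For $\rho=L$, $\nu=\alpha_{n-1}$ this identity is the Hom-Nambu identity; $(\mathcal{N},L,\alpha_{n-1})$ is called the adjoint representation.) Two representations $(V,\rho,\nu)$ and $(V',\rho',\nu')$ are isomorphic (equivalent) if there is a vector space isomorphism $f:V\to V'$ with $f(\rho(x)v)=\rho'(x)f(v)$ for all $x\in\mathcal{N}^{n-1}$, $v\in V$, and $f\circ\nu=\nu'\circ f$.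
   Formalization: The isomorphism in item 2 is claimed for finite-dimensional N (N and N* are never isomorphic otherwise), and skew-symmetry of the representations is claimed when L is skew-symmetric in x_1,…,x_{n-1}, which is necessary; all other representation axioms hold without it. *)

theory Defs
  imports
    "HOL-Computational_Algebra.Polynomial"
    "HOL-Library.Function_Algebras"
begin

text \<open>
  A vector space over the field \<open>'k\<close> is an additive group type with a scalar multiplication
  \<open>s\<close> satisfying \<^term>\<open>vector_space s\<close>. The algebra is the whole type \<open>'v\<close>. A representation
  space is a subspace \<open>V\<close> of such a space, because the dual space is not a type of its own but
  a subspace of \<open>'v \<Rightarrow> 'k\<close>. Tuples are lists: \<open>br [x\<^sub>1, \<dots>, x\<^sub>n]\<close> is the bracket, and only its
  values on lists of length \<open>n\<close> matter. The twisting maps are \<open>\<alpha> 1, \<dots>, \<alpha> (n - 1)\<close>.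
\<close>

definition multilinear ::
    "nat \<Rightarrow> ('k::field \<Rightarrow> 'v::ab_group_add \<Rightarrow> 'v) \<Rightarrow> ('k \<Rightarrow> 'w::ab_group_add \<Rightarrow> 'w)
      \<Rightarrow> ('v list \<Rightarrow> 'w) \<Rightarrow> bool" where
  "multilinear k s t \<phi> \<longleftrightarrow>
    (\<forall>xs ys. length xs + 1 + length ys = k \<longrightarrow> Vector_Spaces.linear s t (\<lambda>z. \<phi> (xs @ z # ys)))"

definition skew_symmetric :: "nat \<Rightarrow> 'w::ab_group_add set \<Rightarrow> ('v list \<Rightarrow> 'w \<Rightarrow> 'w) \<Rightarrow> bool" where
  "skew_symmetric k V \<rho> \<longleftrightarrow>
    (\<forall>xs i j. length xs = k \<and> i < j \<and> j < k \<longrightarrow>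
      (\<forall>v\<in>V. \<rho> (xs[i := xs ! j, j := xs ! i]) v = - \<rho> xs v))"

definition twist :: "(nat \<Rightarrow> 'v \<Rightarrow> 'v) \<Rightarrow> 'v list \<Rightarrow> 'v list" where
  "twist \<alpha> xs = map2 \<alpha> [1..<length xs + 1] xs"

text \<open>
  With \<open>m = length ys\<close> and \<open>1 \<le> i \<le> m\<close>, this is
  \<open>(\<alpha>\<^sub>1 y\<^sub>1, \<dots>, \<alpha>\<^sub>i\<^sub>-\<^sub>1 y\<^sub>i\<^sub>-\<^sub>1, z, \<alpha>\<^sub>i y\<^sub>i\<^sub>+\<^sub>1, \<dots>, \<alpha>\<^sub>m\<^sub>-\<^sub>1 y\<^sub>m)\<close>.
\<close>

definition twist_at :: "(nat \<Rightarrow> 'v \<Rightarrow> 'v) \<Rightarrow> 'v list \<Rightarrow> nat \<Rightarrow> 'v \<Rightarrow> 'v list" where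
  "twist_at \<alpha> ys i z =
    map2 \<alpha> [1..<i] (take (i - 1) ys) @ z # map2 \<alpha> [i..<length ys] (drop i ys)"

definition hom_nambu ::
    "nat \<Rightarrow> ('k::field \<Rightarrow> 'v::ab_group_add \<Rightarrow> 'v) \<Rightarrow> ('v list \<Rightarrow> 'v) \<Rightarrow> (nat \<Rightarrow> 'v \<Rightarrow> 'v) \<Rightarrow> bool" where
  "hom_nambu n s br \<alpha> \<longleftrightarrow>
    2 \<le> n \<and> vector_space s \<and> multilinear n s s br \<and>
    (\<forall>i\<in>{1..n-1}. Vector_Spaces.linear s s (\<alpha> i)) \<and>
    (\<forall>xs ys. length xs = n - 1 \<and> length ys = n \<longrightarrow>
      br (twist \<alpha> xs @ [br ys]) =
        (\<Sum>i=1..n. br (twist_at \<alpha> ys i (br (xs @ [ys ! (i - 1)])))))"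

definition bilinear_form ::
    "('k::field \<Rightarrow> 'v::ab_group_add \<Rightarrow> 'v) \<Rightarrow> ('v \<Rightarrow> 'v \<Rightarrow> 'k) \<Rightarrow> bool" where
  "bilinear_form s B \<longleftrightarrow>
    (\<forall>y. Vector_Spaces.linear s (*) (\<lambda>x. B x y)) \<and> (\<forall>x. Vector_Spaces.linear s (*) (B x))"

definition quadratic_hom_nambu ::
    "nat \<Rightarrow> ('k::field \<Rightarrow> 'v::ab_group_add \<Rightarrow> 'v) \<Rightarrow> ('v list \<Rightarrow> 'v) \<Rightarrow> (nat \<Rightarrow> 'v \<Rightarrow> 'v)
      \<Rightarrow> ('v \<Rightarrow> 'v \<Rightarrow> 'k) \<Rightarrow> bool" where
  "quadratic_hom_nambu n s br \<alpha> B \<longleftrightarrow>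
    hom_nambu n s br \<alpha> \<and> bilinear_form s B \<and>
    (\<forall>x y. B x y = B y x) \<and>
    (\<forall>x. (\<forall>y. B x y = 0) \<longrightarrow> x = 0) \<and>
    (\<forall>xs y z. length xs = n - 1 \<longrightarrow> B (br (xs @ [y])) z + B y (br (xs @ [z])) = 0) \<and>
    (\<forall>i\<in>{1..n-1}. \<forall>y z. B (\<alpha> i y) z = B y (\<alpha> i z))"

definition linear_on ::
    "'v set \<Rightarrow> ('k \<Rightarrow> 'v::ab_group_add \<Rightarrow> 'v) \<Rightarrow> ('k \<Rightarrow> 'w::ab_group_add \<Rightarrow> 'w)
      \<Rightarrow> ('v \<Rightarrow> 'w) \<Rightarrow> bool" where
  "linear_on V s t f \<longleftrightarrow>
    (\<forall>u\<in>V. \<forall>v\<in>V. f (u + v) = f u + f v) \<and> (\<forall>c. \<forall>v\<in>V. f (s c v) = t c (f v))"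

definition End :: "'w set \<Rightarrow> ('k \<Rightarrow> 'w::ab_group_add \<Rightarrow> 'w) \<Rightarrow> ('w \<Rightarrow> 'w) set" where
  "End V t = {f. f ` V \<subseteq> V \<and> linear_on V t t f}"

definition L :: "('v list \<Rightarrow> 'v) \<Rightarrow> 'v list \<Rightarrow> 'v \<Rightarrow> 'v" where
  "L br xs z = br (xs @ [z])"

text \<open>
  A representation is an action that is moreover skew-symmetric. The two are kept apart because
  the bracket of a Hom-Nambu algebra need not be skew-symmetric: \<open>L\<close> is always an action, but a
  representation exactly when it is itself skew-symmetric.
\<close>

definition nambu_action ::
    "nat \<Rightarrow> ('k::field \<Rightarrow> 'v::ab_group_add \<Rightarrow> 'v) \<Rightarrow> ('v list \<Rightarrow> 'v) \<Rightarrow> (nat \<Rightarrow> 'v \<Rightarrow> 'v)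
      \<Rightarrow> ('k \<Rightarrow> 'w::ab_group_add \<Rightarrow> 'w) \<Rightarrow> 'w set \<Rightarrow> ('v list \<Rightarrow> 'w \<Rightarrow> 'w) \<Rightarrow> ('w \<Rightarrow> 'w) \<Rightarrow> bool" where
  "nambu_action n s br \<alpha> t V \<rho> \<nu> \<longleftrightarrow>
    vector_space t \<and> module.subspace t V \<and>
    (\<forall>xs. length xs = n - 1 \<longrightarrow> \<rho> xs \<in> End V t) \<and>
    (\<forall>v\<in>V. multilinear (n - 1) s t (\<lambda>xs. \<rho> xs v)) \<and>
    \<nu> \<in> End V t \<and>
    (\<forall>xs ys. length xs = n - 1 \<and> length ys = n - 1 \<longrightarrow>
      (\<forall>v\<in>V. \<rho> (twist \<alpha> xs) (\<rho> ys v) - \<rho> (twist \<alpha> ys) (\<rho> xs v) =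
        (\<Sum>i=1..n-1. \<rho> (twist_at \<alpha> ys i (L br xs (ys ! (i - 1)))) (\<nu> v))))"

definition nambu_representation ::
    "nat \<Rightarrow> ('k::field \<Rightarrow> 'v::ab_group_add \<Rightarrow> 'v) \<Rightarrow> ('v list \<Rightarrow> 'v) \<Rightarrow> (nat \<Rightarrow> 'v \<Rightarrow> 'v)
      \<Rightarrow> ('k \<Rightarrow> 'w::ab_group_add \<Rightarrow> 'w) \<Rightarrow> 'w set \<Rightarrow> ('v list \<Rightarrow> 'w \<Rightarrow> 'w) \<Rightarrow> ('w \<Rightarrow> 'w) \<Rightarrow> bool" where
  "nambu_representation n s br \<alpha> t V \<rho> \<nu> \<longleftrightarrow> nambu_action n s br \<alpha> t V \<rho> \<nu> \<and> skew_symmetric (n - 1) V \<rho>"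

definition isomorphic ::
    "nat \<Rightarrow> ('k \<Rightarrow> 'w::ab_group_add \<Rightarrow> 'w) \<Rightarrow> 'w set \<Rightarrow> ('v list \<Rightarrow> 'w \<Rightarrow> 'w) \<Rightarrow> ('w \<Rightarrow> 'w)
      \<Rightarrow> ('k \<Rightarrow> 'u::ab_group_add \<Rightarrow> 'u) \<Rightarrow> 'u set \<Rightarrow> ('v list \<Rightarrow> 'u \<Rightarrow> 'u) \<Rightarrow> ('u \<Rightarrow> 'u) \<Rightarrow> bool" where
  "isomorphic n t V \<rho> \<nu> t' V' \<rho>' \<nu>' \<longleftrightarrow>
    (\<exists>f. bij_betw f V V' \<and> linear_on V t t' f \<and>
      (\<forall>xs. length xs = n - 1 \<longrightarrow> (\<forall>v\<in>V. f (\<rho> xs v) = \<rho>' xs (f v))) \<and>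
      (\<forall>v\<in>V. f (\<nu> v) = \<nu>' (f v)))"

definition dual :: "('k::field \<Rightarrow> 'v::ab_group_add \<Rightarrow> 'v) \<Rightarrow> ('v \<Rightarrow> 'k) set" where
  "dual s = {f. Vector_Spaces.linear s (*) f}"

definition scale_fun :: "'k::times \<Rightarrow> ('v \<Rightarrow> 'k) \<Rightarrow> 'v \<Rightarrow> 'k" where
  "scale_fun c f = (\<lambda>x. c * f x)"

definition L_dual :: "('v list \<Rightarrow> 'v) \<Rightarrow> 'v list \<Rightarrow> ('v \<Rightarrow> 'k::uminus) \<Rightarrow> 'v \<Rightarrow> 'k" where
  "L_dual br xs f = (\<lambda>y. - f (L br xs y))"

definition pullback :: "('v \<Rightarrow> 'v) \<Rightarrow> ('v \<Rightarrow> 'k) \<Rightarrow> 'v \<Rightarrow> 'k" where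
  "pullback a f = f \<circ> a"

end

theory Submission
  imports Defs
begin

text \<open>
  The invariance of \<open>B\<close> says that \<open>B (L x y) z = - B y (L x z)\<close>, so \<open>x \<mapsto> B x\<close> intertwines \<open>L\<close> with
  \<open>L_dual\<close>. The action identity of the dual, evaluated at \<open>f\<close> and \<open>z\<close>, says that \<open>f\<close> vanishes on a
  certain vector; that vector is zero because pairing it with an arbitrary \<open>w\<close> moves all operators
  across \<open>B\<close>, which yields the Hom-Nambu identity applied to \<open>w\<close>. This step uses only
  nondegeneracy, so it is valid in any dimension; surjectivity of \<open>x \<mapsto> B x\<close> onto the dual needs
  finite dimension.
\<close>

section \<open>Twisted tuples with one more entry appended\<close>

lemma twist_at_append:
  assumes "1 \<le> i" "i \<le> length ys"
  shows "twist_at \<alpha> (ys @ [v]) i z = twist_at \<alpha> ys i z @ [\<alpha> (length ys) v]"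
  using assms by (simp add: twist_at_def)

text \<open>This case and the previous one split the Hom-Nambu sum for \<open>ys @ [v]\<close>:
  inserting inside \<open>ys\<close> leaves \<open>v\<close> under the last twisting map, the \<nu>
  of the adjoint action, while inserting in place of \<open>v\<close> twists \<open>ys\<close> in
  the ordinary way.\<close>

lemma twist_at_append_last:
  "twist_at \<alpha> (ys @ [v]) (Suc (length ys)) z = twist \<alpha> ys @ [z]"
  by (simp add: twist_at_def twist_def)

lemma length_twist [simp]: "length (twist \<alpha> xs) = length xs"
  by (simp add: twist_def del: upt_Suc)

lemma length_twist_at [simp]:
  assumes "1 \<le> i" "i \<le> length ys"
  shows "length (twist_at \<alpha> ys i z) = length ys"
  using assms by (simp add: twist_at_def)

section \<open>Linear maps and the dual space\<close>

lemma linear_iff_vector_space: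
  assumes "vector_space s" "vector_space t"
  shows "Vector_Spaces.linear s t f \<longleftrightarrow>
    (\<forall>x y. f (x + y) = f x + f y) \<and> (\<forall>c x. f (s c x) = t c (f x))"
  using assms by (simp add: Vector_Spaces.linear_iff)

lemma vector_space_times: "vector_space ((*) :: 'k::field \<Rightarrow> 'k \<Rightarrow> 'k)"
  by unfold_locales (simp_all add: algebra_simps)

lemma vector_space_scale_fun:
  "vector_space (scale_fun :: 'k::field \<Rightarrow> ('v \<Rightarrow> 'k) \<Rightarrow> 'v \<Rightarrow> 'k)"
  by unfold_locales (simp_all add: scale_fun_def algebra_simps fun_eq_iff)

lemma mem_dual_iff:
  assumes "vector_space s"
  shows "f \<in> dual s \<longleftrightarrow>
    (\<forall>x y. f (x + y) = f x + f y) \<and> (\<forall>c x. f (s c x) = c * f x)"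
  using linear_iff_vector_space[OF assms vector_space_times] by (simp add: dual_def)

lemma subspace_dual:
  assumes "vector_space s"
  shows "module.subspace scale_fun (dual s)"
proof -
  interpret F: vector_space "scale_fun :: 'a \<Rightarrow> ('b \<Rightarrow> 'a) \<Rightarrow> 'b \<Rightarrow> 'a"
    by (rule vector_space_scale_fun)
  show ?thesis
    by (auto simp: F.subspace_def mem_dual_iff[OF assms] scale_fun_def algebra_simps)
qed

section \<open>The adjoint action\<close>

lemma hom_nambu_linear_L:
  assumes "hom_nambu n s br \<alpha>" "length xs = n - 1"
  shows "Vector_Spaces.linear s s (L br xs)"
proof -
  have "length xs + 1 + length [] = n" using assms by (auto simp: hom_nambu_def)
  then have "Vector_Spaces.linear s s (\<lambda>z. br (xs @ z # []))"
    using assms unfolding hom_nambu_def multilinear_def by blast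
  then show ?thesis by (simp add: L_def[abs_def])
qed

lemma hom_nambu_linear_L_arg:
  assumes "hom_nambu n s br \<alpha>" "length xs + 1 + length ys = n - 1"
  shows "Vector_Spaces.linear s s (\<lambda>z. L br (xs @ z # ys) v)"
proof -
  have "length xs + 1 + length (ys @ [v]) = n" using assms(2) by simp
  then have "Vector_Spaces.linear s s (\<lambda>z. br (xs @ z # (ys @ [v])))"
    using assms(1) unfolding hom_nambu_def multilinear_def by blast
  then show ?thesis by (simp add: L_def)
qed

text \<open>The Hom-Nambu identity for \<open>ys @ [v]\<close> with its last summand moved to the
  left: that summand is the second product, and all the others act on
  \<open>\<alpha> (n - 1) v\<close>.\<close>

lemma hom_nambu_L_identity:
  assumes "hom_nambu n s br \<alpha>" "length xs = n - 1" "length ys = n - 1"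
  shows "L br (twist \<alpha> xs) (L br ys v) - L br (twist \<alpha> ys) (L br xs v) =
    (\<Sum>i=1..n-1. L br (twist_at \<alpha> ys i (L br xs (ys ! (i - 1)))) (\<alpha> (n - 1) v))"
proof -
  let ?t = "\<lambda>i. br (twist_at \<alpha> (ys @ [v]) i (br (xs @ [(ys @ [v]) ! (i - 1)])))"
  have n: "n = Suc (length ys)" using assms by (auto simp: hom_nambu_def)
  have "length (ys @ [v]) = n" using n by simp
  then have "br (twist \<alpha> xs @ [br (ys @ [v])]) = sum ?t {1..n}"
    using assms(1,2) unfolding hom_nambu_def by blast
  also have "\<dots> = sum ?t {1..n-1} + ?t n"
    unfolding n by simp
  also have "?t n = L br (twist \<alpha> ys) (L br xs v)"
    unfolding n twist_at_append_last by (simp add: L_def)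
  also have "sum ?t {1..n-1} =
      (\<Sum>i=1..n-1. L br (twist_at \<alpha> ys i (L br xs (ys ! (i - 1)))) (\<alpha> (n - 1) v))"
    unfolding n by (intro sum.cong) (auto simp: twist_at_append nth_append L_def)
  finally show ?thesis by (simp add: L_def)
qed

lemma nambu_action_L:
  assumes "hom_nambu n s br \<alpha>"
  shows "nambu_action n s br \<alpha> s UNIV (L br) (\<alpha> (n - 1))"
proof -
  have vs: "vector_space s" and n: "2 \<le> n"
    and \<alpha>: "\<And>i. i \<in> {1..n-1} \<Longrightarrow> Vector_Spaces.linear s s (\<alpha> i)"
    using assms by (auto simp: hom_nambu_def)
  have End: "f \<in> End UNIV s" if "Vector_Spaces.linear s s f" for f
    using that by (simp add: End_def linear_on_def linear_iff_vector_space[OF vs vs])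
  have sub: "module.subspace s UNIV"
    using vs by (simp add: module.subspace_UNIV module_iff_vector_space)
  have \<alpha>': "\<alpha> (n - 1) \<in> End UNIV s"
    using n by (intro End \<alpha>) simp
  show ?thesis
    unfolding nambu_action_def multilinear_def
    by (intro conjI allI ballI impI vs sub \<alpha>' End hom_nambu_linear_L[OF assms]
        hom_nambu_linear_L_arg[OF assms] hom_nambu_L_identity[OF assms]) simp_all
qed

section \<open>The action on the dual space\<close>

lemma bilinear_form_sum:
  assumes "bilinear_form s B"
  shows "B (sum g A) z = (\<Sum>i\<in>A. B (g i) z)"
    and "B z (sum g A) = (\<Sum>i\<in>A. B z (g i))"
proof -
  have "module_hom s (*) (\<lambda>x. B x z)"
    using assms by (simp add: bilinear_form_def module_hom_iff_linear)
  then show "B (sum g A) z = (\<Sum>i\<in>A. B (g i) z)"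
    by (rule module_hom.sum)
  have "module_hom s (*) (B z)"
    using assms by (simp add: bilinear_form_def module_hom_iff_linear)
  then show "B z (sum g A) = (\<Sum>i\<in>A. B z (g i))"
    by (rule module_hom.sum)
qed

text \<open>The dual action identity with the functional stripped off. Two applications of
  \<open>L_dual\<close> cancel their signs and compose in reverse order, so the twisted tuples act
  first here; the right side comes from a single \<open>L_dual\<close> and keeps its sign.\<close>

lemma dual_action_identity:
  assumes Q: "quadratic_hom_nambu n s br \<alpha> B"
    and xs: "length xs = n - 1" and ys: "length ys = n - 1"
  shows "L br ys (L br (twist \<alpha> xs) z) - L br xs (L br (twist \<alpha> ys) z) =
    - (\<Sum>i=1..n-1. \<alpha> (n - 1) (L br (twist_at \<alpha> ys i (L br xs (ys ! (i - 1)))) z))"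
    (is "?l - ?r = - (\<Sum>i\<in>_. \<alpha> _ (L br (?t i) z))")
proof -
  have H: "hom_nambu n s br \<alpha>" and B: "bilinear_form s B"
    and nondeg: "\<And>x. (\<And>y. B x y = 0) \<Longrightarrow> x = 0"
    and inv: "\<And>xs y z. length xs = n - 1 \<Longrightarrow> B (L br xs y) z = - B y (L br xs z)"
    and sym: "\<And>i y z. i \<in> {1..n-1} \<Longrightarrow> B (\<alpha> i y) z = B y (\<alpha> i z)"
    using Q by (auto simp: quadratic_hom_nambu_def L_def eq_neg_iff_add_eq_0)
  have n: "n - 1 \<in> {1..n-1}" using H by (auto simp: hom_nambu_def)
  have add: "B (x + y) z = B x z + B y z" "B z (x + y) = B z x + B z y" for x y z
    using B by (simp_all add: bilinear_form_def Vector_Spaces.linear_iff)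
  have diff: "B z (x - y) = B z x - B z y" for x y z
    using add(2)[of z "x - y" y] by simp
  have diff': "B (x - y) z = B x z - B y z" for x y z
    using add(1)[of "x - y" y z] by simp
  have "?l - ?r + (\<Sum>i=1..n-1. \<alpha> (n - 1) (L br (?t i) z)) = 0"
  proof (rule nondeg)
    fix w
    \<comment> \<open>\<open>sym\<close> moves \<open>\<alpha> (n - 1)\<close> onto
      \<open>w\<close>, then \<open>inv\<close> moves \<open>L\<close> across at the cost of a sign:
      the summands become those of the adjoint identity at \<open>w\<close>.\<close>
    have "B (\<Sum>i=1..n-1. \<alpha> (n - 1) (L br (?t i) z)) w =
        - (\<Sum>i=1..n-1. B z (L br (?t i) (\<alpha> (n - 1) w)))"
      unfolding bilinear_form_sum(1)[OF B] sum_negf[symmetric]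
      using ys by (intro sum.cong) (simp_all add: sym[OF n] inv del: One_nat_def)
    also have "\<dots> = - B z (L br (twist \<alpha> xs) (L br ys w) - L br (twist \<alpha> ys) (L br xs w))"
      by (simp add: hom_nambu_L_identity[OF H xs ys] bilinear_form_sum(2)[OF B])
    \<comment> \<open>Each product crosses \<open>B\<close> in two moves, which reverses its order
      and cancels its signs.\<close>
    also have "\<dots> = - B (?l - ?r) w"
      using xs ys by (simp add: diff diff' inv)
    finally show "B (?l - ?r + (\<Sum>i=1..n-1. \<alpha> (n - 1) (L br (?t i) z))) w = 0"
      by (simp add: add)
  qed
  then show ?thesis by (simp add: eq_neg_iff_add_eq_0)
qed

lemma nambu_action_L_dual:
  assumes Q: "quadratic_hom_nambu n s br \<alpha> B"
  shows "nambu_action n s br \<alpha> scale_fun (dual s) (L_dual br) (pullback (\<alpha> (n - 1)))"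
proof -
  have H: "hom_nambu n s br \<alpha>" using Q by (simp add: quadratic_hom_nambu_def)
  have vs: "vector_space s" and \<alpha>: "Vector_Spaces.linear s s (\<alpha> (n - 1))"
    using H by (auto simp: hom_nambu_def)
  note lin = linear_iff_vector_space[OF vs vs] mem_dual_iff[OF vs]
  have End_L: "L_dual br xs \<in> End (dual s) scale_fun" if "length xs = n - 1" for xs
    using hom_nambu_linear_L[OF H that] unfolding lin
    by (auto simp: End_def linear_on_def lin L_dual_def scale_fun_def fun_eq_iff)
  have End_\<alpha>: "pullback (\<alpha> (n - 1)) \<in> End (dual s) scale_fun"
    using \<alpha> unfolding lin
    by (auto simp: End_def linear_on_def lin pullback_def scale_fun_def fun_eq_iff)
  have multi: "multilinear (n - 1) s scale_fun (\<lambda>xs. L_dual br xs f)" if "f \<in> dual s" for f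
    using that hom_nambu_linear_L_arg[OF H]
    unfolding multilinear_def linear_iff_vector_space[OF vs vector_space_scale_fun] lin
    by (simp add: L_dual_def scale_fun_def fun_eq_iff)
  have ident: "L_dual br (twist \<alpha> xs) (L_dual br ys f) - L_dual br (twist \<alpha> ys) (L_dual br xs f) =
      (\<Sum>i=1..n-1. L_dual br (twist_at \<alpha> ys i (L br xs (ys ! (i - 1)))) (pullback (\<alpha> (n - 1)) f))"
    if xs: "length xs = n - 1" and ys: "length ys = n - 1" and f: "f \<in> dual s" for xs ys f
  proof
    fix z
    interpret f: module_hom s "(*)" f
      using f by (simp add: dual_def module_hom_iff_linear)
    have sum_apply: "sum g A z = (\<Sum>i\<in>A. g i z)" for A and g :: "nat \<Rightarrow> 'b \<Rightarrow> 'a"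
      by (induction A rule: infinite_finite_induct) simp_all
    show "(L_dual br (twist \<alpha> xs) (L_dual br ys f) - L_dual br (twist \<alpha> ys) (L_dual br xs f)) z =
      (\<Sum>i=1..n-1. L_dual br (twist_at \<alpha> ys i (L br xs (ys ! (i - 1)))) (pullback (\<alpha> (n - 1)) f)) z"
      \<comment> \<open>Applying the linear \<open>f\<close> to the vector identity at
        \<open>z\<close> gives the dual identity evaluated at \<open>z\<close>.\<close>
      using arg_cong[OF dual_action_identity[OF Q xs ys, of z], of f]
      by (simp add: sum_apply L_dual_def pullback_def f.diff f.neg f.sum sum_negf)
  qed
  show ?thesis
    unfolding nambu_action_def
    using vector_space_scale_fun subspace_dual[OF vs] End_L End_\<alpha> multi ident
    by (intro conjI allI ballI impI) simp_all
qed

lemma skew_symmetric_L_dual: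
  assumes "skew_symmetric k UNIV (L br)" "vector_space s"
  shows "skew_symmetric k (dual s) (L_dual br)"
  unfolding skew_symmetric_def
proof (intro allI impI ballI ext)
  fix xs :: "'a list" and i j f y
  assume *: "length xs = k \<and> i < j \<and> j < k" and f: "f \<in> dual s"
  interpret f: module_hom s "(*)" f
    using f by (simp add: dual_def module_hom_iff_linear)
  show "L_dual br (xs[i := xs ! j, j := xs ! i]) f y = (- L_dual br xs f) y"
    using assms(1) * unfolding skew_symmetric_def by (simp add: L_dual_def f.neg)
qed

section \<open>The isomorphism given by the form\<close>

lemma bij_betw_nondegenerate_dual:
  fixes s :: "'k::field \<Rightarrow> 'v::ab_group_add \<Rightarrow> 'v"
  assumes "finite_dimensional_vector_space s Basis" and B: "bilinear_form s B"
    and nondeg: "\<And>x. (\<And>y. B x y = 0) \<Longrightarrow> x = 0"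
  shows "bij_betw B UNIV (dual s)"
proof -
  interpret finite_dimensional_vector_space s Basis by fact
  interpret P: vector_space_pair s "(*) :: 'k \<Rightarrow> 'k \<Rightarrow> 'k"
    by (intro vector_space_pair.intro vector_space_axioms vector_space_times)
  have lin: "Vector_Spaces.linear s (*) (B x)" for x
    using B by (simp add: bilinear_form_def)
  have add: "B (x + y) z = B x z + B y z" and scale: "B (s c x) z = c * B x z" for x y z c
    using B by (simp_all add: bilinear_form_def Vector_Spaces.linear_iff)
  have diff: "B (x - y) z = B x z - B y z" for x y z
    using add[of "x - y" y z] by simp
  have eq_on_Basis: "f = g"
    if "f \<in> dual s" "g \<in> dual s" "\<And>b. b \<in> Basis \<Longrightarrow> f b = g b" for f g
    using that P.linear_eq_on[of f g _ Basis] by (auto simp: dual_def span_Basis)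
  have inj_B: "inj B"
    by (rule injI) (metis diff nondeg right_minus_eq)
  have coord: "f b = g b"
    if "(\<Sum>b\<in>Basis. s (f b) b) = (\<Sum>b\<in>Basis. s (g b) b)" "b \<in> Basis" for f g b
  proof -
    have "(\<Sum>b\<in>Basis. s (f b - g b) b) = 0"
      using that(1) by (simp add: scale_left_diff_distrib sum_subtractf)
    then show ?thesis
      using independentD[OF independent_Basis finite_Basis subset_refl _ that(2)] by fastforce
  qed
  \<comment> \<open>\<open>?T x\<close> stores the values of \<open>B x\<close> on
    \<open>Basis\<close> as coordinates of a vector. This moves the question from the dual into the
    space itself, where finite dimension makes an injective linear endomorphism surjective.\<close>
  let ?T = "\<lambda>x. \<Sum>b\<in>Basis. s (B x b) b"
  have "Vector_Spaces.linear s s ?T"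
    unfolding linear_iff_vector_space[OF vector_space_axioms vector_space_axioms]
    by (simp add: add scale scale_left_distrib sum.distrib scale_sum_right)
  moreover have "inj ?T"
  proof (rule injI)
    fix x y assume "?T x = ?T y"
    then have "B x = B y"
      using lin by (intro eq_on_Basis coord) (simp_all add: dual_def)
    then show "x = y" using inj_B by (simp add: inj_eq)
  qed
  ultimately have surj: "surj ?T"
    by (rule linear_inj_imp_surj)
  have "f \<in> range B" if "f \<in> dual s" for f
  proof -
    \<comment> \<open>The vector encoding \<open>f\<close> in the same way has a preimage under
      \<open>?T\<close>; equal coordinates make \<open>f\<close> and \<open>B x\<close> agree on
      \<open>Basis\<close>, hence everywhere.\<close>
    obtain x where "(\<Sum>b\<in>Basis. s (f b) b) = ?T x"
      using surj by (rule surjE)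
    then have "f = B x"
      using lin that by (intro eq_on_Basis coord) (simp_all add: dual_def)
    then show ?thesis by simp
  qed
  then show ?thesis
    using inj_B lin by (auto simp: bij_betw_def dual_def)
qed

text \<open>The isomorphism is \<open>B\<close> in curried form: invariance gives the intertwining
  with \<open>L_dual\<close>, and self-adjointness of \<open>\<alpha> (n - 1)\<close> the
  compatibility with \<open>pullback\<close>.\<close>

lemma isomorphic_L_L_dual:
  assumes "finite_dimensional_vector_space s Basis" "quadratic_hom_nambu n s br \<alpha> B"
  shows "isomorphic n s UNIV (L br) (\<alpha> (n - 1))
    scale_fun (dual s) (L_dual br) (pullback (\<alpha> (n - 1)))"
proof -
  have H: "hom_nambu n s br \<alpha>" and B: "bilinear_form s B"
    and nondeg: "\<And>x. (\<And>y. B x y = 0) \<Longrightarrow> x = 0"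
    and inv: "\<And>xs y z. length xs = n - 1 \<Longrightarrow> B (L br xs y) z = - B y (L br xs z)"
    and sym: "\<And>i y z. i \<in> {1..n-1} \<Longrightarrow> B (\<alpha> i y) z = B y (\<alpha> i z)"
    using assms(2) by (auto simp: quadratic_hom_nambu_def L_def eq_neg_iff_add_eq_0)
  have n: "n - 1 \<in> {1..n-1}" using H by (auto simp: hom_nambu_def)
  have "linear_on UNIV s scale_fun B"
    using B by (simp add: linear_on_def bilinear_form_def Vector_Spaces.linear_iff scale_fun_def fun_eq_iff)
  then show ?thesis
    unfolding isomorphic_def
    using bij_betw_nondegenerate_dual[OF assms(1) B nondeg] inv sym[OF n]
    by (intro exI[of _ B]) (simp add: fun_eq_iff L_dual_def pullback_def)
qed

text \<open>Skew-symmetry passes from \<open>L\<close> to \<open>L_dual\<close>, so it upgrades both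
  actions to representations. The isomorphism is conditional on finite dimension because the dual of
  an infinite-dimensional space has strictly larger dimension.\<close>

theorem proposition4p5:
  fixes s :: "'k::{alg_closed_field, field_char_0} \<Rightarrow> 'v::ab_group_add \<Rightarrow> 'v"
    and n :: nat
    and br :: "'v list \<Rightarrow> 'v"
    and \<alpha> :: "nat \<Rightarrow> 'v \<Rightarrow> 'v"
  assumes "hom_nambu n s br \<alpha>"
    and "\<exists>B. quadratic_hom_nambu n s br \<alpha> B"
  shows "(nambu_action n s br \<alpha> scale_fun (dual s) (L_dual br) (pullback (\<alpha> (n - 1))) \<and>
      (skew_symmetric (n - 1) UNIV (L br) \<longrightarrow>
        nambu_representation n s br \<alpha> scale_fun (dual s) (L_dual br) (pullback (\<alpha> (n - 1))))) \<and>
    (nambu_action n s br \<alpha> s UNIV (L br) (\<alpha> (n - 1)) \<and>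
      (skew_symmetric (n - 1) UNIV (L br) \<longrightarrow>
        nambu_representation n s br \<alpha> s UNIV (L br) (\<alpha> (n - 1))) \<and>
      ((\<exists>Basis. finite_dimensional_vector_space s Basis) \<longrightarrow>
        isomorphic n s UNIV (L br) (\<alpha> (n - 1))
          scale_fun (dual s) (L_dual br) (pullback (\<alpha> (n - 1)))))"
proof -
  obtain B where B: "quadratic_hom_nambu n s br \<alpha> B"
    using assms(2) by blast
  have "vector_space s"
    using assms(1) by (simp add: hom_nambu_def)
  then show ?thesis
    using nambu_action_L_dual[OF B] nambu_action_L[OF assms(1)] isomorphic_L_L_dual[OF _ B]
    by (auto simp: nambu_representation_def skew_symmetric_L_dual)
qed

end
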